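(* For every $m \in \mathbb{N}$ there is a constant $c_m>0$ such that for every $n \geq 1$ there exist $m$ $n$-pencils in the real projective plane whose centres are in general position (no three of the $m$ centres are collinear) and which determine at least $c_m n^{3/2}$ $m$-rich points.
   Context: An $n$-pencil with centre $p \in P^2(\mathbb{R})$ is a set of $n$ distinct concurrent lines all passing through $p$. Given $m$ pencils, a point is called $m$-rich if it lies on at least one line from each of the $m$ pencils. *)

theory Defs
  imports "HOL-Analysis.Analysis"
begin

text \<open>
  The real projective plane is the projectivisation of \<open>real ^ 3\<close>: points and lines are the linear
  subspaces of dimension 1 and 2, and a point lies on a line iff it is contained in it as a subspace.
\<close>

definition proj_points :: "(real ^ 3) set set" where
  "proj_points = {p. subspace p \<and> dim p = 1}"

definition proj_lines :: "(real ^ 3) set set" where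
  "proj_lines = {l. subspace l \<and> dim l = 2}"

definition lies_on :: "(real ^ 3) set \<Rightarrow> (real ^ 3) set \<Rightarrow> bool" where
  "lies_on p l \<longleftrightarrow> p \<in> proj_points \<and> l \<in> proj_lines \<and> p \<subseteq> l"

definition proj_collinear :: "(real ^ 3) set set \<Rightarrow> bool" where
  "proj_collinear A \<longleftrightarrow> (\<exists>l\<in>proj_lines. \<forall>p\<in>A. lies_on p l)"

definition no_three_collinear :: "(real ^ 3) set set \<Rightarrow> bool" where
  "no_three_collinear A \<longleftrightarrow> (\<forall>T. T \<subseteq> A \<and> card T = 3 \<longrightarrow> \<not> proj_collinear T)"

definition is_pencil :: "nat \<Rightarrow> (real ^ 3) set \<Rightarrow> (real ^ 3) set set \<Rightarrow> bool" where
  "is_pencil n p L \<longleftrightarrow>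
     p \<in> proj_points \<and> L \<subseteq> proj_lines \<and> finite L \<and> card L = n \<and> (\<forall>l\<in>L. lies_on p l)"

text \<open>The \<open>m\<close> pencils are the members \<open>L 0, \<dots>, L (m - 1)\<close> of the family \<open>L\<close>.\<close>

definition rich_points :: "nat \<Rightarrow> (nat \<Rightarrow> (real ^ 3) set set) \<Rightarrow> (real ^ 3) set set" where
  "rich_points m L = {q \<in> proj_points. \<forall>i<m. \<exists>l\<in>L i. lies_on q l}"

end

theory Submission
  imports Defs
begin

text \<open>
  Projecting the integer points of the box \<open>{1..N}\<^sup>3\<close> from a centre with bounded integer coordinates
  yields only \<open>O(N\<^sup>2)\<close> directions, so \<open>O(N\<^sup>2)\<close> lines through that centre cover the box. A positive
  proportion of the \<open>N\<^sup>3\<close> triples is primitive, and distinct primitive positive triples represent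
  distinct projective points. So with any \<open>m\<close> fixed centres, here \<open>(1, -i, i\<^sup>2)\<close> on a conic, pencils of
  size \<open>n \<sim> N\<^sup>2\<close> have about \<open>n\<^sup>3\<^sup>/\<^sup>2\<close> rich points.
\<close>

section \<open>Homogeneous coordinates for points and lines\<close>

definition vec3 :: "real \<Rightarrow> real \<Rightarrow> real \<Rightarrow> real ^ 3" where
  "vec3 x y z = vector [x, y, z]"

lemma inner_vec3: "vec3 a b c \<bullet> vec3 x y z = a * x + b * y + c * z"
  by (simp add: vec3_def inner_vec_def sum_3)

lemma scaleR_vec3: "r *\<^sub>R vec3 x y z = vec3 (r * x) (r * y) (r * z)"
  by (simp add: vec3_def vec_eq_iff forall_3)

lemma vec3_eq_iff: "vec3 a b c = vec3 x y z \<longleftrightarrow> a = x \<and> b = y \<and> c = z"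
  by (auto simp: vec3_def vec_eq_iff forall_3)

lemma zero_eq_vec3: "0 = vec3 0 0 0"
  by (simp add: vec3_def vec_eq_iff forall_3)

lemma vec3_cases: obtains a b c where "v = vec3 a b c"
proof
  show "v = vec3 (v $ 1) (v $ 2) (v $ 3)"
    by (simp add: vec3_def vec_eq_iff forall_3)
qed

definition hom_point :: "real \<Rightarrow> real \<Rightarrow> real \<Rightarrow> (real ^ 3) set" where
  "hom_point x y z = span {vec3 x y z}"

definition hom_line :: "real \<Rightarrow> real \<Rightarrow> real \<Rightarrow> (real ^ 3) set" where
  "hom_line a b c = {v. vec3 a b c \<bullet> v = 0}"

lemma hom_point_in_proj_points:
  assumes "x \<noteq> 0 \<or> y \<noteq> 0 \<or> z \<noteq> 0"
  shows "hom_point x y z \<in> proj_points"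
proof -
  have "vec3 x y z \<noteq> 0"
    using assms by (auto simp: zero_eq_vec3 vec3_eq_iff)
  then show ?thesis
    by (simp add: hom_point_def proj_points_def dim_span)
qed

lemma hom_line_in_proj_lines:
  assumes "a \<noteq> 0 \<or> b \<noteq> 0 \<or> c \<noteq> 0"
  shows "hom_line a b c \<in> proj_lines"
proof -
  have "vec3 a b c \<noteq> 0"
    using assms by (auto simp: zero_eq_vec3 vec3_eq_iff)
  then have "dim (hom_line a b c) = 2"
    by (simp add: hom_line_def dim_hyperplane)
  then show ?thesis
    by (simp add: hom_line_def proj_lines_def subspace_hyperplane)
qed

lemma vec3_in_hom_line: "vec3 x y z \<in> hom_line a b c \<longleftrightarrow> a * x + b * y + c * z = 0"
  by (simp add: hom_line_def inner_vec3)

lemma vec3_in_hom_point: "vec3 x y z \<in> hom_point x y z"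
  by (simp add: hom_point_def span_base)

lemma lies_on_hom:
  assumes "x \<noteq> 0 \<or> y \<noteq> 0 \<or> z \<noteq> 0" "a \<noteq> 0 \<or> b \<noteq> 0 \<or> c \<noteq> 0" "a * x + b * y + c * z = 0"
  shows "lies_on (hom_point x y z) (hom_line a b c)"
proof -
  have "hom_point x y z \<subseteq> hom_line a b c"
    unfolding hom_point_def
  proof (rule span_minimal)
    show "{vec3 x y z} \<subseteq> hom_line a b c"
      using assms(3) by (simp add: vec3_in_hom_line)
    show "subspace (hom_line a b c)"
      by (simp add: hom_line_def subspace_hyperplane)
  qed
  then show ?thesis
    using assms(1,2) by (simp add: lies_on_def hom_point_in_proj_points hom_line_in_proj_lines)
qed

text \<open>A proper subspace of \<open>real ^ 3\<close> has a nonzero normal vector, and its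
  coordinates are the coefficients of an equation that holds on the abstract line.\<close>

lemma proj_line_subset_hom_line:
  assumes "l \<in> proj_lines"
  obtains a b c where "a \<noteq> 0 \<or> b \<noteq> 0 \<or> c \<noteq> 0" "l \<subseteq> hom_line a b c"
proof -
  have "dim l < DIM(real ^ 3)" "span l = l"
    using assms by (simp_all add: proj_lines_def)
  then obtain v where v: "v \<noteq> 0" "l \<subseteq> {x. v \<bullet> x = 0}"
    using lowdim_subset_hyperplane by metis
  obtain a b c where abc: "v = vec3 a b c"
    by (rule vec3_cases)
  have "a \<noteq> 0 \<or> b \<noteq> 0 \<or> c \<noteq> 0"
    using v(1) abc by (auto simp: zero_eq_vec3 vec3_eq_iff)
  moreover have "l \<subseteq> hom_line a b c"
    using v(2) abc by (simp add: hom_line_def)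
  ultimately show ?thesis
    using that by blast
qed

text \<open>Generators of the same span are proportional, so all 2x2 minors of the pair
  vanish.\<close>

lemma hom_point_eq_imp_cross:
  assumes "hom_point x y z = hom_point x' y' z'"
  shows "x * y' = y * x'" "x * z' = z * x'" "y * z' = z * y'"
proof -
  have "vec3 x y z \<in> hom_point x' y' z'"
    using assms vec3_in_hom_point by metis
  then obtain r where "vec3 x y z = r *\<^sub>R vec3 x' y' z'"
    by (auto simp: hom_point_def span_singleton)
  then show "x * y' = y * x'" "x * z' = z * x'" "y * z' = z * y'"
    by (auto simp: scaleR_vec3 vec3_eq_iff)
qed

section \<open>Centres on a conic\<close>

text \<open>The minus sign makes \<open>y + i * x\<close> a linear form that vanishes at the centre
  but is positive at every positive triple, so it can serve as a denominator on the whole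
  box.\<close>

definition centre :: "nat \<Rightarrow> (real ^ 3) set" where
  "centre i = hom_point 1 (- real i) ((real i)\<^sup>2)"

lemma inj_centre: "inj centre"
proof (rule injI)
  fix i j assume "centre i = centre j"
  then show "i = j"
    using hom_point_eq_imp_cross(1)[of 1 "- real i" "(real i)\<^sup>2" 1 "- real j" "(real j)\<^sup>2"]
    by (simp add: centre_def)
qed

lemma quadratic_three_roots_imp_zero:
  fixes a b c :: real
  assumes "a + b * x + c * x\<^sup>2 = 0" "a + b * y + c * y\<^sup>2 = 0" "a + b * z + c * z\<^sup>2 = 0"
    and "x \<noteq> y" "x \<noteq> z" "y \<noteq> z"
  shows "a = 0 \<and> b = 0 \<and> c = 0"
proof -
  \<comment> \<open>Differences of two equations factor; dividing by the difference of the roots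
    lowers the degree, and a second difference isolates \<open>c\<close>.\<close>
  have "(x - y) * (b + c * (x + y)) = 0" "(x - z) * (b + c * (x + z)) = 0"
    using assms(1-3) by algebra+
  then have "b + c * (x + y) = 0" "b + c * (x + z) = 0"
    using assms(4,5) by auto
  moreover from this have "c * (y - z) = 0"
    by algebra
  ultimately show ?thesis
    using assms(1,6) by auto
qed

text \<open>A line with coefficients \<open>a\<close>, \<open>b\<close>, \<open>c\<close> contains
  \<open>centre i\<close> only if \<open>i\<close> is a root of \<open>a - b * t + c * t^2\<close>;
  a nonzero polynomial of degree at most 2 does not have three distinct roots.\<close>

lemma no_three_collinear_centres: "no_three_collinear (centre ` A)"
  unfolding no_three_collinear_def
proof (intro allI impI notI)
  fix T assume T: "T \<subseteq> centre ` A \<and> card T = 3" and "proj_collinear T"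
  then obtain l where l: "l \<in> proj_lines" "\<forall>p\<in>T. lies_on p l"
    by (auto simp: proj_collinear_def)
  obtain a b c where abc: "a \<noteq> 0 \<or> b \<noteq> 0 \<or> c \<noteq> 0" "l \<subseteq> hom_line a b c"
    using proj_line_subset_hom_line[OF l(1)] .
  have zero: "a + (- b) * real i + c * (real i)\<^sup>2 = 0" if "centre i \<in> T" for i
  proof -
    have "vec3 1 (- real i) ((real i)\<^sup>2) \<in> hom_line a b c"
      using that l(2) abc(2) vec3_in_hom_point by (fastforce simp: lies_on_def centre_def)
    then show ?thesis
      by (simp add: vec3_in_hom_line)
  qed
  obtain p q r where pqr: "T = {p, q, r}" "p \<noteq> q" "p \<noteq> r" "q \<noteq> r"
    using T by (auto simp: card_3_iff)
  then obtain i j k where "p = centre i" "q = centre j" "r = centre k"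
    using T by auto
  then show False
    using quadratic_three_roots_imp_zero[of a "- b" "real i" c "real j" "real k"] zero pqr abc(1)
    by auto
qed

section \<open>Pencils parametrised by a slope\<close>

text \<open>This is the line \<open>z - i^2 * x = s * (y + i * x)\<close>. Both linear forms vanish
  at \<open>centre i\<close>, so every real \<open>s\<close> gives a line through that
  centre.\<close>

definition pencil_line :: "nat \<Rightarrow> real \<Rightarrow> (real ^ 3) set" where
  "pencil_line i s = hom_line (- (real i)\<^sup>2 - s * real i) (- s) 1"

lemma inj_pencil_line: "inj (pencil_line i)"
proof (rule injI)
  fix s t assume "pencil_line i s = pencil_line i t"
  \<comment> \<open>The intersection with the line \<open>x = 0\<close> is (0, 1, s), from which the
    parameter can be read off.\<close>
  moreover have "vec3 0 1 s \<in> pencil_line i s"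
    by (simp add: pencil_line_def vec3_in_hom_line)
  ultimately have "vec3 0 1 s \<in> pencil_line i t"
    by simp
  then show "s = t"
    by (simp add: pencil_line_def vec3_in_hom_line)
qed

lemma is_pencil_pencil_line:
  assumes "finite R"
  shows "is_pencil (card R) (centre i) (pencil_line i ` R)"
  unfolding is_pencil_def
proof (intro conjI ballI)
  show "centre i \<in> proj_points"
    by (simp add: centre_def hom_point_in_proj_points)
  show "pencil_line i ` R \<subseteq> proj_lines"
    by (auto simp: pencil_line_def hom_line_in_proj_lines)
  show "finite (pencil_line i ` R)"
    using assms by simp
  show "card (pencil_line i ` R) = card R"
    using inj_pencil_line by (metis card_image inj_on_subset top_greatest)
  show "lies_on (centre i) l" if "l \<in> pencil_line i ` R" for l
    using that unfolding pencil_line_def centre_def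
    by (auto intro!: lies_on_hom simp: power2_eq_square algebra_simps)
qed

text \<open>The parameter \<open>s\<close> for which \<open>pencil_line i s\<close> passes through
  the point with coordinates x, y, z, found by solving the equation of the line for
  \<open>s\<close>.\<close>

definition slope :: "nat \<Rightarrow> nat \<times> nat \<times> nat \<Rightarrow> real" where
  "slope i = (\<lambda>(x, y, z). (real z - (real i)\<^sup>2 * real x) / (real y + real i * real x))"

lemma lies_on_slope:
  assumes "y > 0"
  shows "lies_on (hom_point (real x) (real y) (real z)) (pencil_line i (slope i (x, y, z)))"
  unfolding pencil_line_def
proof (rule lies_on_hom)
  define s where "s = slope i (x, y, z)"
  have "real y + real i * real x > 0"
    using assms by (simp add: add_pos_nonneg)
  then have "s * (real y + real i * real x) = real z - (real i)\<^sup>2 * real x"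
    by (simp add: s_def slope_def)
  then show "(- (real i)\<^sup>2 - slope i (x, y, z) * real i) * real x + - slope i (x, y, z) * real y + 1 * real z = 0"
    unfolding s_def[symmetric] by (simp add: algebra_simps)
qed (use assms in auto)

section \<open>Primitive triples and their density\<close>

definition primitive_triples :: "nat \<Rightarrow> (nat \<times> nat \<times> nat) set" where
  "primitive_triples N = {(x, y, z) \<in> {1..N} \<times> {1..N} \<times> {1..N}. gcd x (gcd y z) = 1}"

lemma finite_primitive_triples: "finite (primitive_triples N)"
  by (rule finite_subset[of _ "{1..N} \<times> {1..N} \<times> {1..N}"]) (auto simp: primitive_triples_def)

lemma inj_on_hom_point_primitive_triples:
  "inj_on (\<lambda>(x, y, z). hom_point (real x) (real y) (real z)) (primitive_triples N)"
proof (rule inj_onI, clarsimp)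
  fix x y z x' y' z' :: nat
  assume mem: "(x, y, z) \<in> primitive_triples N" "(x', y', z') \<in> primitive_triples N"
    and eq: "hom_point (real x) (real y) (real z) = hom_point (real x') (real y') (real z')"
  note cross = hom_point_eq_imp_cross[OF eq, folded of_nat_mult, unfolded of_nat_eq_iff]
  have g: "gcd x (gcd y z) = 1" "gcd x' (gcd y' z') = 1"
    using mem by (auto simp: primitive_triples_def)
  have mult: "gcd (k * u) (gcd (k * v) (k * w)) = k * gcd u (gcd v w)" for k u v w :: nat
    by (metis gcd_mult_distrib_nat)
  \<comment> \<open>The vanishing minors say that \<open>x\<close> times the second triple equals
    \<open>x'\<close> times the first. By primitivity the gcds of these two multiples are
    \<open>x\<close> and \<open>x'\<close>.\<close>
  have "x = gcd (x * x') (gcd (x * y') (x * z'))"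
    unfolding mult g by simp
  also have "\<dots> = gcd (x' * x) (gcd (x' * y) (x' * z))"
    using cross by (simp add: mult.commute)
  also have "\<dots> = x'"
    unfolding mult g by simp
  finally have x: "x = x'" .
  then show "x = x' \<and> y = y' \<and> z = z'"
    using cross mem by (auto simp: primitive_triples_def)
qed

text \<open>Each term is at most half of \<open>1 / (d - 1) - 1 / d\<close>, and these differences
  telescope. The bound 1/2 is what leaves half of the box to the primitive triples.\<close>

lemma sum_inverse_cubes_le:
  assumes "N \<ge> 1"
  shows "(\<Sum>d = 2..N. 1 / real d ^ 3) \<le> 1 / 2 - 1 / (2 * real N)"
  using assms
proof (induction N rule: dec_induct)
  case base
  then show ?case by simp
next
  case (step N)
  \<comment> \<open>This is \<open>(N + 1)^2 \<ge> 2 * N\<close> multiplied by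
    \<open>N + 1\<close>.\<close>
  have "real (Suc N) ^ 3 \<ge> 2 * real N * real (Suc N)"
    by (simp add: power3_eq_cube algebra_simps)
  then have "1 / real (Suc N) ^ 3 \<le> 1 / (2 * real N * real (Suc N))"
    using step by (intro divide_left_mono) auto
  also have "\<dots> = 1 / (2 * real N) - 1 / (2 * real (Suc N))"
    using step by (simp add: field_simps)
  finally show ?case
    using step by simp
qed

text \<open>A triple with gcd \<open>d \<ge> 2\<close> is \<open>d\<close> times a triple from the
  box of side \<open>N div d\<close>. A union bound over \<open>d\<close> therefore leaves at most
  \<open>N^3 / 2\<close> triples that are not primitive.\<close>

lemma card_primitive_triples_ge: "real (card (primitive_triples N)) \<ge> real N ^ 3 / 2"
proof (cases "N = 0")
  case False
  define B where "B = (\<lambda>k::nat. {1..k} \<times> {1..k} \<times> {1..k})"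
  define scale where "scale = (\<lambda>d (x, y, z). (d * x, d * y, d * z :: nat))"
  have finB: "finite (B k)" and cardB: "card (B k) = k ^ 3" for k
    by (simp_all add: B_def card_cartesian_product power3_eq_cube)
  have cover: "B N \<subseteq> primitive_triples N \<union> (\<Union>d\<in>{2..N}. scale d ` B (N div d))"
  proof
    fix t assume "t \<in> B N"
    then obtain x y z where t: "t = (x, y, z)" "x \<in> {1..N}" "y \<in> {1..N}" "z \<in> {1..N}"
      by (auto simp: B_def)
    define d where "d = gcd x (gcd y z)"
    have "d dvd x" "d dvd y" "d dvd z"
      unfolding d_def by (meson dvd_trans gcd_dvd1 gcd_dvd2)+
    then obtain x' y' z' where d: "x = d * x'" "y = d * y'" "z = d * z'"
      by (auto elim!: dvdE)
    have pos: "d > 0"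
      using t(2) d(1) by (cases d) auto
    show "t \<in> primitive_triples N \<union> (\<Union>d\<in>{2..N}. scale d ` B (N div d))"
    proof (cases "d = 1")
      case True
      then show ?thesis
        using t by (simp add: primitive_triples_def d_def)
    next
      case False
      have "d \<le> x"
        using \<open>d dvd x\<close> t(2) by (intro dvd_imp_le) auto
      then have "d \<in> {2..N}"
        using pos False t(2) by simp
      moreover have "(x', y', z') \<in> B (N div d)"
        using t(2-4) d pos by (auto simp: B_def less_eq_div_iff_mult_less_eq mult.commute Suc_le_eq)
      moreover have "t = scale d (x', y', z')"
        by (simp add: t(1) d scale_def)
      ultimately show ?thesis
        by blast
    qed
  qed
  have "N ^ 3 \<le> card (primitive_triples N \<union> (\<Union>d\<in>{2..N}. scale d ` B (N div d)))"
    unfolding cardB[symmetric] using cover finB finite_primitive_triples by (intro card_mono) auto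
  also have "\<dots> \<le> card (primitive_triples N) + card (\<Union>d\<in>{2..N}. scale d ` B (N div d))"
    by (rule card_Un_le)
  also have "card (\<Union>d\<in>{2..N}. scale d ` B (N div d)) \<le> (\<Sum>d=2..N. card (scale d ` B (N div d)))"
    by (rule card_UN_le) simp
  also have "\<dots> \<le> (\<Sum>d=2..N. (N div d) ^ 3)"
    unfolding cardB[symmetric] by (intro sum_mono card_image_le finB)
  finally have "real (N ^ 3) \<le> real (card (primitive_triples N) + (\<Sum>d=2..N. (N div d) ^ 3))"
    using of_nat_mono by fastforce
  also have "\<dots> = real (card (primitive_triples N)) + (\<Sum>d=2..N. real (N div d) ^ 3)"
    by simp
  also have "(\<Sum>d=2..N. real (N div d) ^ 3) \<le> (\<Sum>d=2..N. (real N / real d) ^ 3)"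
    by (intro sum_mono power_mono of_nat_div_le_of_nat) simp
  also have "\<dots> = real N ^ 3 * (\<Sum>d=2..N. 1 / real d ^ 3)"
    by (simp add: sum_distrib_left power_divide)
  also have "\<dots> \<le> real N ^ 3 * (1 / 2)"
  proof (rule mult_left_mono)
    have "1 / (2 * real N) \<ge> 0"
      by simp
    then show "(\<Sum>d=2..N. 1 / real d ^ 3) \<le> 1 / 2"
      using sum_inverse_cubes_le[of N] False by linarith
  qed simp
  finally show ?thesis
    by simp
qed simp

section \<open>Few slopes from each centre\<close>

text \<open>Every slope is a quotient of two integers from intervals of length proportional to
  \<open>N\<close>, so counting numerator-denominator pairs gives a bound quadratic in
  \<open>N\<close>.\<close>

lemma card_slopes_le:
  assumes "i < m" "N \<ge> 1"
  shows "card (slope i ` primitive_triples N) \<le> (m * (m\<^sup>2 + 2)) * N\<^sup>2"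
proof -
  define A where "A = {1..int (m * N)} \<times> {- int (m\<^sup>2 * N)..int N}"
  define f where "f = (\<lambda>(a, b). real_of_int b / real_of_int a)"
  have sub: "slope i ` primitive_triples N \<subseteq> f ` A"
  proof (rule image_subsetI)
    fix t assume "t \<in> primitive_triples N"
    then obtain x y z where t: "t = (x, y, z)" "x \<in> {1..N}" "y \<in> {1..N}" "z \<in> {1..N}"
      by (auto simp: primitive_triples_def)
    \<comment> \<open>Using \<open>i \<le> m - 1\<close> leaves room for the summand
      \<open>y \<le> N\<close> below \<open>m * N\<close>.\<close>
    have "i * x \<le> (m - 1) * N"
      using assms(1) t(2) by (intro mult_mono) auto
    then have "y + i * x \<le> N + (m - 1) * N"
      using t(3) by simp
    also have "\<dots> = m * N"
      using assms(1) by (cases m) auto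
    finally have "int (y + i * x) \<le> int (m * N)"
      by linarith
    moreover have "y + i * x \<ge> 1"
      using t(3) by simp
    then have "int (y + i * x) \<ge> 1"
      by linarith
    moreover have "i\<^sup>2 * x \<le> m\<^sup>2 * N"
      using assms(1) t(2) by (intro mult_mono power_mono) auto
    then have "- int (m\<^sup>2 * N) \<le> int z - int (i\<^sup>2 * x)" "int z - int (i\<^sup>2 * x) \<le> int N"
      using t(4) by (simp_all only: atLeastAtMost_iff) linarith+
    ultimately have "(int (y + i * x), int z - int (i\<^sup>2 * x)) \<in> A"
      by (simp only: A_def mem_Times_iff fst_conv snd_conv atLeastAtMost_iff)
    moreover have "slope i t = f (int (y + i * x), int z - int (i\<^sup>2 * x))"
      by (simp add: t(1) f_def slope_def)
    ultimately show "slope i t \<in> f ` A"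
      by blast
  qed
  have finA: "finite A"
    by (simp add: A_def)
  have "card (slope i ` primitive_triples N) \<le> card (f ` A)"
    using sub finA by (intro card_mono) auto
  also have "\<dots> \<le> card A"
    by (rule card_image_le[OF finA])
  also have "\<dots> = m * N * nat (int N + int (m\<^sup>2 * N) + 1)"
    by (simp add: A_def card_cartesian_product flip: of_nat_mult)
  also have "nat (int N + int (m\<^sup>2 * N) + 1) = N + m\<^sup>2 * N + 1"
    by linarith
  \<comment> \<open>The extra 1, from counting both endpoints of the numerator range, is absorbed by
    \<open>N \<ge> 1\<close>; hence \<open>m\<^sup>2 + 2\<close>.\<close>
  also have "m * N * (N + m\<^sup>2 * N + 1) \<le> m * N * ((m\<^sup>2 + 2) * N)"
    using assms(2) by (intro mult_left_mono) (auto simp: algebra_simps)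
  also have "\<dots> = (m * (m\<^sup>2 + 2)) * N\<^sup>2"
    by (simp add: power2_eq_square algebra_simps)
  finally show ?thesis .
qed

text \<open>The lines given by the slopes already cover the primitive triples. Padding each slope
  set with arbitrary further reals makes every pencil have exactly \<open>n\<close> lines and keeps
  these points rich.\<close>

lemma pencils_through_primitive_triples:
  assumes "\<And>i. i < m \<Longrightarrow> card (slope i ` primitive_triples N) \<le> n"
  obtains L S where "\<forall>i<m. is_pencil n (centre i) (L i)"
    "S \<subseteq> rich_points m L" "finite S" "card S = card (primitive_triples N)"
proof -
  have "\<exists>R. finite R \<and> card R = n \<and> slope i ` primitive_triples N \<subseteq> R" if "i < m" for i
  proof -
    define F where "F = slope i ` primitive_triples N"
    have F: "finite F"
      by (simp add: F_def finite_primitive_triples)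
    then have "infinite (UNIV - F)"
      by (simp add: infinite_UNIV_char_0)
    then obtain E where E: "finite E" "card E = n - card F" "E \<subseteq> UNIV - F"
      using infinite_arbitrarily_large by blast
    then have "card (F \<union> E) = n"
      using F assms[OF that] by (subst card_Un_disjoint) (auto simp: F_def)
    then show ?thesis
      using E(1) F unfolding F_def by blast
  qed
  then obtain R where R: "\<And>i. i < m \<Longrightarrow> finite (R i) \<and> card (R i) = n \<and> slope i ` primitive_triples N \<subseteq> R i"
    by metis
  define L where "L = (\<lambda>i. pencil_line i ` R i)"
  define S where "S = (\<lambda>(x, y, z). hom_point (real x) (real y) (real z)) ` primitive_triples N"
  show ?thesis
  proof
    show "\<forall>i<m. is_pencil n (centre i) (L i)"
      using R is_pencil_pencil_line unfolding L_def by metis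
    show "S \<subseteq> rich_points m L"
      unfolding S_def
    proof (rule image_subsetI)
      fix t assume t: "t \<in> primitive_triples N"
      then obtain x y z where xyz: "t = (x, y, z)" "x > 0" "y > 0"
        by (auto simp: primitive_triples_def)
      then have "hom_point (real x) (real y) (real z) \<in> proj_points"
        by (intro hom_point_in_proj_points) auto
      moreover have "pencil_line i (slope i t) \<in> L i" if "i < m" for i
        using R[OF that] t by (auto simp: L_def)
      then have "\<forall>i<m. \<exists>l\<in>L i. lies_on (hom_point (real x) (real y) (real z)) l"
        using lies_on_slope[OF xyz(3)] xyz(1) by blast
      ultimately show "(case t of (x, y, z) \<Rightarrow> hom_point (real x) (real y) (real z)) \<in> rich_points m L"
        by (simp add: rich_points_def xyz(1))
    qed
    show "finite S"
      by (simp add: S_def finite_primitive_triples)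
    show "card S = card (primitive_triples N)"
      unfolding S_def by (rule card_image[OF inj_on_hom_point_primitive_triples])
  qed
qed

section \<open>Choice of the box size and conclusion\<close>

lemma powr_three_halves: "0 \<le> x \<Longrightarrow> x powr (3 / 2) = sqrt x ^ 3"
  using powr_power[of x "1 / 2" 3] by (cases "x = 0") (simp_all add: powr_half_sqrt)

text \<open>The second alternative covers the small \<open>n\<close>, for which only the point \<open>(1, 1, 1)\<close> is used.\<close>

lemma exists_box_size:
  fixes K n :: nat
  assumes "K \<ge> 1"
  obtains N where "N \<ge> 1" "K * N\<^sup>2 \<le> n \<or> N = 1"
    "real N ^ 3 \<ge> real n powr (3 / 2) / (8 * sqrt (real K) ^ 3)"
proof -
  \<comment> \<open>The real solution of \<open>K * r^2 = n\<close>; rounding it down keeps the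
    slope bound within \<open>n\<close>.\<close>
  define r where "r = sqrt (real n / real K)"
  define N where "N = max 1 (nat \<lfloor>r\<rfloor>)"
  have r: "r \<ge> 0"
    by (simp add: r_def)
  have "K * N\<^sup>2 \<le> n" if "N \<noteq> 1"
  proof -
    have "real N \<le> r"
      using that r unfolding N_def by linarith
    then have "(real N)\<^sup>2 \<le> r\<^sup>2"
      by (intro power_mono) auto
    then have "real K * (real N)\<^sup>2 \<le> real n"
      using assms by (simp add: r_def field_simps)
    then show ?thesis
      by (metis of_nat_le_iff of_nat_mult of_nat_power)
  qed
  \<comment> \<open>Rounding costs at most a factor 2: \<open>N = 1\<close> if \<open>r < 1\<close>,
    and the floor of \<open>r\<close> exceeds \<open>r / 2\<close> otherwise. Its cube is the 8 in
    the bound.\<close>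
  moreover have "r \<le> 2 * real N"
    using r unfolding N_def by linarith
  then have "r ^ 3 \<le> (2 * real N) ^ 3"
    using r by (intro power_mono)
  then have "real N ^ 3 \<ge> real n powr (3 / 2) / (8 * sqrt (real K) ^ 3)"
    using assms by (simp add: r_def powr_three_halves real_sqrt_divide power_divide power_mult_distrib field_simps)
  ultimately show ?thesis
    using that[of N] unfolding N_def by linarith
qed

text \<open>The set of rich points can be infinite, for instance when \<open>m \<le> 1\<close>, and
  \<open>card\<close> would then be 0; the lower bound is therefore expressed through a finite
  subset \<open>S\<close>.\<close>

theorem theorem4:
  fixes m :: nat
  shows "\<exists>c::real. c > 0 \<and>
    (\<forall>n::nat. n \<ge> 1 \<longrightarrow>
      (\<exists>(p :: nat \<Rightarrow> (real ^ 3) set) (L :: nat \<Rightarrow> (real ^ 3) set set).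
        (\<forall>i<m. is_pencil n (p i) (L i)) \<and>
        inj_on p {..<m} \<and> no_three_collinear (p ` {..<m}) \<and>
        (\<exists>S. S \<subseteq> rich_points m L \<and> finite S \<and> real (card S) \<ge> c * real n powr (3 / 2))))"
proof -
  \<comment> \<open>The factor from the slope count, plus 1 to stay positive when
    \<open>m = 0\<close>.\<close>
  define K where "K = m * (m\<^sup>2 + 2) + 1"
  \<comment> \<open>16 is the rounding loss 8 times the loss 2 from passing to primitive
    triples.\<close>
  define c where "c = 1 / (16 * sqrt (real K) ^ 3)"
  have "K > 0"
    by (simp add: K_def)
  then have "c > 0"
    by (simp add: c_def)
  moreover have "\<exists>p L. (\<forall>i<m. is_pencil n (p i) (L i)) \<and>
        inj_on p {..<m} \<and> no_three_collinear (p ` {..<m}) \<and>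
        (\<exists>S. S \<subseteq> rich_points m L \<and> finite S \<and> real (card S) \<ge> c * real n powr (3 / 2))"
    if "n \<ge> 1" for n
  proof -
    obtain N where N: "N \<ge> 1" "K * N\<^sup>2 \<le> n \<or> N = 1"
      "real N ^ 3 \<ge> real n powr (3 / 2) / (8 * sqrt (real K) ^ 3)"
      using exists_box_size[of K n] \<open>K > 0\<close> by auto
    have "card (slope i ` primitive_triples N) \<le> n" if "i < m" for i
      using N(2)
    proof
      assume "K * N\<^sup>2 \<le> n"
      then show ?thesis
        using card_slopes_le[OF that N(1)] by (simp add: K_def)
    next
      assume "N = 1"
      then have "primitive_triples N = {(1, 1, 1)}"
        by (auto simp: primitive_triples_def)
      then show ?thesis
        using \<open>n \<ge> 1\<close> by simp
    qed
    then obtain L S where LS: "\<forall>i<m. is_pencil n (centre i) (L i)"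
      "S \<subseteq> rich_points m L" "finite S" "card S = card (primitive_triples N)"
      by (rule pencils_through_primitive_triples)
    have "c * real n powr (3 / 2) = real n powr (3 / 2) / (8 * sqrt (real K) ^ 3) / 2"
      by (simp add: c_def)
    also have "\<dots> \<le> real N ^ 3 / 2"
      using N(3) by simp
    also have "\<dots> \<le> real (card S)"
      using card_primitive_triples_ge[of N] LS(4) by simp
    finally have "real (card S) \<ge> c * real n powr (3 / 2)" .
    moreover have "inj_on centre {..<m}"
      using inj_centre by (rule inj_on_subset) simp
    ultimately show ?thesis
      using LS no_three_collinear_centres by blast
  qed
  ultimately show ?thesis
    by blast
qed

end
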